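(* For any $\mu>\mu_0$ and any $p\in\mathbb{T}^3$ the operator $h_\mu(p)$ has a unique eigenvalue $e_\mu(p)$ below the bottom $m(p)$ of its essential spectrum. One has $$e_\mu(p)<e_{\mu_0}(p)<m(p),\qquad 0\neq p\in\mathbb{T}^3,$$ and $$e_\mu(0)<0 .$$
   Context: $\mathbb{T}^3$ is the three-dimensional torus, identified with the cube $(-\pi,\pi]^3$ with opposite sides identified. Let $$\varepsilon(p)=3-\cos p_1-\cos p_2-\cos p_3,\qquad u(p,q)=\varepsilon(p)+\varepsilon(p-q)+\varepsilon(q),\qquad p,q\in\mathbb{T}^3 .$$ Let $\varphi$ be a real-analytic (real-valued) even function on $\mathbb{T}^3$, not identically zero. For $\mu>0$ and $p\in\mathbb{T}^3$ let $h_\mu(p)=h_0(p)-\mu v$ be the bounded self-adjoint operator on $L_2(\mathbb{T}^3)$, where $$(h_0(p)f)(q)=u(p,q)f(q),\qquad (vf)(q)=\varphi(q)\int_{\mathbb{T}^3}\varphi(t)f(t)\,dt .$$ Put $m(p)=\min_{q\in\mathbb{T}^3}u(p,q)$ and $M(p)=\max_{q\in\mathbb{T}^3}u(p,q)$; the essential spectrum of $h_\mu(p)$ is $[m(p),M(p)]$. Define $$\mu_0=\Big(\int_{\mathbb{T}^3}\varphi^2(t)\,(u(0,t))^{-1}\,dt\Big)^{-1}.$$ For $0\neq p\in\mathbb{T}^3$, $e_{\mu_0}(p)$ denotes the unique strictly positive eigenvalue of $h_{\mu_0}(p)$ below $m(p)$ (its existence and uniqueness is a separate theorem of the paper).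
   Formalization: For p≠0 it is assumed, at the p considered, that h_{μ_0}(p) has a unique strictly positive eigenvalue below m(p), i.e. that e_{μ_0}(p) exists; this fails for some φ, e.g. φ=exp(N(cos t_1+cos t_2+cos t_3)), N large, p=(2π/3,2π/3,2π/3), and then the claim for every μ>μ_0 fails too. *)

theory Defs
  imports "HOL-Analysis.Analysis"
begin

text \<open>
  The torus is represented by the fundamental cube; functions on it are represented by functions
  on \<open>real ^ 3\<close> that are \<open>2 * pi\<close>-periodic in every coordinate, so that \<open>p - q\<close> and \<open>- q\<close>
  need no explicit reduction to the cube.
\<close>

definition torus :: "(real ^ 3) set" where
  "torus = {x. \<forall>i. - pi < x $ i \<and> x $ i \<le> pi}"

abbreviation torus_measure :: "(real ^ 3) measure" where
  "torus_measure \<equiv> lebesgue_on torus"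

definition torus_periodic :: "(real ^ 3 \<Rightarrow> 'a) \<Rightarrow> bool" where
  "torus_periodic f \<longleftrightarrow> (\<forall>x i. f (x + axis i (2 * pi)) = f x)"

text \<open>
  Real-analyticity: near every point the function is the unconditionally convergent sum of a power
  series in three variables; the exponents are multi-indices in \<open>nat ^ 3\<close>.
\<close>

definition real_analytic :: "(real ^ 3 \<Rightarrow> real) \<Rightarrow> bool" where
  "real_analytic f \<longleftrightarrow>
     (\<forall>x. \<exists>r>0. \<exists>a :: nat ^ 3 \<Rightarrow> real. \<forall>y\<in>ball x r.
        ((\<lambda>k. a k * (\<Prod>i\<in>UNIV. (y $ i - x $ i) ^ (k $ i))) has_sum f y) UNIV)"

text \<open>Elements of \<open>L\<^sub>2\<close> are represented by functions; they are identified up to null sets.\<close>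

definition L2_torus :: "(real ^ 3 \<Rightarrow> complex) set" where
  "L2_torus = {f. f \<in> borel_measurable torus_measure \<and>
                  integrable torus_measure (\<lambda>q. (cmod (f q))\<^sup>2)}"

definition eigenvalue ::
  "((real ^ 3 \<Rightarrow> complex) \<Rightarrow> real ^ 3 \<Rightarrow> complex) \<Rightarrow> complex \<Rightarrow> bool" where
  "eigenvalue A z \<longleftrightarrow>
     (\<exists>f\<in>L2_torus. \<not> (AE q in torus_measure. f q = 0) \<and>
                   (AE q in torus_measure. A f q = z * f q))"

definition dispersion :: "real ^ 3 \<Rightarrow> real" where
  "dispersion p = 3 - cos (p $ 1) - cos (p $ 2) - cos (p $ 3)"

definition u :: "real ^ 3 \<Rightarrow> real ^ 3 \<Rightarrow> real" where
  "u p q = dispersion p + dispersion (p - q) + dispersion q"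

definition h0 :: "real ^ 3 \<Rightarrow> (real ^ 3 \<Rightarrow> complex) \<Rightarrow> real ^ 3 \<Rightarrow> complex" where
  "h0 p f q = complex_of_real (u p q) * f q"

definition v :: "(real ^ 3 \<Rightarrow> real) \<Rightarrow> (real ^ 3 \<Rightarrow> complex) \<Rightarrow> real ^ 3 \<Rightarrow> complex" where
  "v \<phi> f q = complex_of_real (\<phi> q) * (LINT t|torus_measure. complex_of_real (\<phi> t) * f t)"

definition h ::
  "(real ^ 3 \<Rightarrow> real) \<Rightarrow> real \<Rightarrow> real ^ 3 \<Rightarrow> (real ^ 3 \<Rightarrow> complex) \<Rightarrow> real ^ 3 \<Rightarrow> complex" where
  "h \<phi> \<mu> p f q = h0 p f q - complex_of_real \<mu> * v \<phi> f q"

text \<open>The minimum of \<open>u p\<close> over the torus, which is the bottom of the essential spectrum of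
  \<open>h \<phi> \<mu> p\<close>.\<close>

definition m :: "real ^ 3 \<Rightarrow> real" where
  "m p = (LEAST x. x \<in> u p ` torus)"

text \<open>The integrand is undefined at \<open>t = 0\<close>, where \<open>u 0\<close> vanishes; this is a null set.\<close>

definition mu0 :: "(real ^ 3 \<Rightarrow> real) \<Rightarrow> real" where
  "mu0 \<phi> = inverse (LINT t|torus_measure. (\<phi> t)\<^sup>2 * inverse (u 0 t))"

definition eigenvalue_below :: "(real ^ 3 \<Rightarrow> real) \<Rightarrow> real \<Rightarrow> real ^ 3 \<Rightarrow> real \<Rightarrow> bool" where
  "eigenvalue_below \<phi> \<mu> p z \<longleftrightarrow> eigenvalue (h \<phi> \<mu> p) (complex_of_real z) \<and> z < m p"

text \<open>The following two are meaningful only where such an eigenvalue exists and is unique.\<close>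

definition e :: "(real ^ 3 \<Rightarrow> real) \<Rightarrow> real \<Rightarrow> real ^ 3 \<Rightarrow> real" where
  "e \<phi> \<mu> p = (THE z. eigenvalue_below \<phi> \<mu> p z)"

definition e_mu0 :: "(real ^ 3 \<Rightarrow> real) \<Rightarrow> real ^ 3 \<Rightarrow> real" where
  "e_mu0 \<phi> p = (THE z. 0 < z \<and> eigenvalue_below \<phi> (mu0 \<phi>) p z)"

end

theory Submission
  imports Defs
begin

text \<open>
  The operator \<open>h \<phi> \<mu> p\<close> is multiplication by \<open>u p\<close> minus \<open>\<mu>\<close> times the rank-one operator with
  kernel \<open>\<phi> q * \<phi> t\<close>. If \<open>z\<close> lies below \<open>m p\<close>, the eigenvalue equation can be solved for the
  eigenfunction: it is a multiple of \<open>\<phi> / (u p - z)\<close>. Inserting this into the inner product with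
  \<open>\<phi>\<close> shows that \<open>z\<close> is an eigenvalue exactly when \<open>\<mu> * S z = 1\<close>, where the secular function
  \<open>S z\<close> is the integral of \<open>\<phi>\<^sup>2 / (u p - z)\<close> (\<open>eigenvalue_iff_secular\<close>). The theorem is thus a
  statement about one real function on \<open>{..<m p}\<close>, which is continuous, strictly increasing where
  it does not vanish, and tends to \<open>0\<close> at \<open>- \<infinity>\<close>. So there is at most one eigenvalue below
  \<open>m p\<close>, and one exists below any point \<open>a\<close> at which \<open>\<mu> * S a\<close> exceeds \<open>1\<close>
  (\<open>secular_root_unique\<close>, \<open>secular_root_exists\<close>). It remains to find such points.

  For \<open>p \<noteq> 0\<close> the point is the eigenvalue \<open>e_mu0 \<phi> p\<close> of the critical operator: there
  \<open>mu0 \<phi> * S = 1\<close>, and raising the coupling from \<open>mu0 \<phi>\<close> to \<open>\<mu>\<close> makes the product larger than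
  \<open>1\<close>. This also gives \<open>e \<phi> \<mu> p < e_mu0 \<phi> p\<close>.

  For \<open>p = 0\<close> the threshold is \<open>m 0 = 0\<close>. If \<open>\<mu> * S z\<close> were at most \<open>1\<close> for every negative \<open>z\<close>,
  monotone convergence as \<open>z\<close> increases to \<open>0\<close> would show that \<open>\<phi>\<^sup>2 / u 0\<close> is integrable with
  integral at most \<open>1 / \<mu>\<close>. The integral is positive because \<open>\<phi>\<close> is continuous and not identically
  zero, so its inverse \<open>mu0 \<phi>\<close> would be at least \<open>\<mu>\<close>, contrary to \<open>\<mu> > mu0 \<phi>\<close>
  (\<open>supercritical_secular_0\<close>).
\<close>

section \<open>Rank-one perturbations of multiplication operators\<close>

locale rank_one_perturbation =
  fixes M :: "'a measure" and w g :: "'a \<Rightarrow> real" and b :: real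
  assumes w_measurable [measurable]: "w \<in> borel_measurable M"
    and g_measurable [measurable]: "g \<in> borel_measurable M"
    and g_square_integrable: "integrable M (\<lambda>q. (g q)\<^sup>2)"
    and w_ge: "\<And>q. q \<in> space M \<Longrightarrow> b \<le> w q"
begin

definition secular :: "real \<Rightarrow> real" where
  "secular z = (LINT q|M. (g q)\<^sup>2 / (w q - z))"

lemma resolvent_le:
  assumes "z < b" "q \<in> space M"
  shows "(g q)\<^sup>2 / (w q - z) \<le> (g q)\<^sup>2 / (b - z)"
  using assms w_ge[OF assms(2)] by (intro divide_left_mono) auto

text \<open>
  For \<open>z < b\<close> the resolvent \<open>1 / (w - z)\<close> is bounded by \<open>1 / (b - z)\<close>, so integrability is
  inherited from \<open>g\<^sup>2\<close>; the same comparison makes the secular function small far to the left.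
\<close>

lemma secular_integrable:
  assumes "z < b"
  shows "integrable M (\<lambda>q. (g q)\<^sup>2 / (w q - z))"
proof (rule Bochner_Integration.integrable_bound)
  show "integrable M (\<lambda>q. (g q)\<^sup>2 / (b - z))"
    using g_square_integrable by simp
  show "AE q in M. norm ((g q)\<^sup>2 / (w q - z)) \<le> norm ((g q)\<^sup>2 / (b - z))"
  proof (rule AE_I2)
    fix q assume "q \<in> space M"
    then show "norm ((g q)\<^sup>2 / (w q - z)) \<le> norm ((g q)\<^sup>2 / (b - z))"
      using resolvent_le[OF assms, of q] w_ge[of q] assms by (simp add: abs_div_pos)
  qed
qed measurable

lemma secular_le:
  assumes "z < b"
  shows "secular z \<le> (LINT q|M. (g q)\<^sup>2) / (b - z)"
proof -
  have "secular z \<le> (LINT q|M. (g q)\<^sup>2 / (b - z))"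
    unfolding secular_def
    using g_square_integrable resolvent_le[OF assms]
    by (intro integral_mono secular_integrable assms) auto
  then show ?thesis by simp
qed

lemma resolvent_square_integrable:
  assumes "z < b"
  shows "integrable M (\<lambda>q. (g q / (w q - z))\<^sup>2)"
proof (rule Bochner_Integration.integrable_bound)
  show "integrable M (\<lambda>q. (g q)\<^sup>2 / (b - z)\<^sup>2)"
    using g_square_integrable by simp
  show "AE q in M. norm ((g q / (w q - z))\<^sup>2) \<le> norm ((g q)\<^sup>2 / (b - z)\<^sup>2)"
  proof (rule AE_I2)
    fix q assume "q \<in> space M"
    then have "(b - z)\<^sup>2 \<le> (w q - z)\<^sup>2"
      using w_ge[of q] assms by (intro power_mono) auto
    then show "norm ((g q / (w q - z))\<^sup>2) \<le> norm ((g q)\<^sup>2 / (b - z)\<^sup>2)"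
      using assms by (auto simp: power_divide intro!: divide_left_mono mult_pos_pos)
  qed
qed measurable

text \<open>
  Below \<open>b\<close> the factor \<open>w - z\<close> can be divided out: every eigenfunction is \<open>\<mu> * c\<close> times
  \<open>g / (w - z)\<close>, where \<open>c\<close> is its inner product with \<open>g\<close>. Taking the inner product with \<open>g\<close> again
  gives \<open>c = \<mu> * c * secular z\<close>, and \<open>c\<close> cannot vanish without the eigenfunction vanishing.
\<close>

lemma eigenvalue_iff_secular:
  assumes "z < b"
  shows "(\<exists>f. f \<in> borel_measurable M \<and> integrable M (\<lambda>q. (cmod (f q))\<^sup>2)
            \<and> \<not> (AE q in M. f q = 0)
            \<and> (AE q in M. complex_of_real (w q) * f q
                 - complex_of_real \<mu> * (complex_of_real (g q) * (LINT t|M. complex_of_real (g t) * f t))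
               = complex_of_real z * f q))
         \<longleftrightarrow> \<mu> * secular z = 1"
    (is "?eigen \<longleftrightarrow> _")
proof
  assume ?eigen
  then obtain f where f [measurable]: "f \<in> borel_measurable M" and nz: "\<not> (AE q in M. f q = 0)"
    and eq: "AE q in M. complex_of_real (w q) * f q
                 - complex_of_real \<mu> * (complex_of_real (g q) * (LINT t|M. complex_of_real (g t) * f t))
               = complex_of_real z * f q"
    by blast
  define c where "c = (LINT t|M. complex_of_real (g t) * f t)"
  have f_eq: "AE q in M. f q = complex_of_real \<mu> * c * complex_of_real (g q / (w q - z))"
    using eq AE_space
  proof eventually_elim
    case (elim q)
    have "complex_of_real (w q - z) \<noteq> 0"
      using w_ge[OF elim(2)] assms unfolding of_real_eq_0_iff by simp
    moreover have "complex_of_real (w q - z) * f q = complex_of_real \<mu> * c * complex_of_real (g q)"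
      using elim(1) by (simp add: c_def algebra_simps)
    ultimately show ?case by (simp add: field_simps)
  qed
  have "c \<noteq> 0"
    using nz f_eq by auto
  have "c = (LINT q|M. complex_of_real \<mu> * c * complex_of_real ((g q)\<^sup>2 / (w q - z)))"
  proof (subst c_def, rule integral_cong_AE)
    show "AE q in M. complex_of_real (g q) * f q
        = complex_of_real \<mu> * c * complex_of_real ((g q)\<^sup>2 / (w q - z))"
      using f_eq by eventually_elim (simp add: power2_eq_square)
  qed measurable
  also have "\<dots> = complex_of_real \<mu> * c * complex_of_real (secular z)"
    unfolding secular_def integral_complex_of_real[symmetric] by (rule integral_mult_right_zero)
  finally have "complex_of_real (\<mu> * secular z) = 1"
    using \<open>c \<noteq> 0\<close> by simp
  then show "\<mu> * secular z = 1"
    unfolding of_real_eq_1_iff .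
next
  assume root: "\<mu> * secular z = 1"
  \<comment> \<open>The root condition is what makes this function nonzero and an eigenfunction.\<close>
  define f where "f q = complex_of_real (g q / (w q - z))" for q
  have f_meas: "f \<in> borel_measurable M"
    unfolding f_def by measurable
  have sq: "integrable M (\<lambda>q. (cmod (f q))\<^sup>2)"
    unfolding f_def norm_of_real power2_abs by (rule resolvent_square_integrable[OF assms])
  have overlap: "(LINT t|M. complex_of_real (g t) * f t) = complex_of_real (secular z)"
    unfolding secular_def integral_complex_of_real[symmetric] f_def
    by (simp add: power2_eq_square)
  have "\<not> (AE q in M. f q = 0)"
  proof
    assume "AE q in M. f q = 0"
    then have "AE q in M. complex_of_real (g q) * f q = 0"
      by eventually_elim simp
    then have "(LINT t|M. complex_of_real (g t) * f t) = 0"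
      by (rule integral_eq_zero_AE)
    then show False
      using root overlap by simp
  qed
  moreover have "AE q in M. complex_of_real (w q) * f q
        - complex_of_real \<mu> * (complex_of_real (g q) * (LINT t|M. complex_of_real (g t) * f t))
      = complex_of_real z * f q"
  proof (rule AE_I2)
    fix q assume q: "q \<in> space M"
    have "complex_of_real \<mu> * (complex_of_real (g q) * complex_of_real (secular z))
        = complex_of_real (g q * (\<mu> * secular z))"
      by simp
    also have "\<dots> = complex_of_real (w q - z) * f q"
      using root w_ge[OF q] assms unfolding f_def of_real_mult[symmetric] by simp
    finally show "complex_of_real (w q) * f q
        - complex_of_real \<mu> * (complex_of_real (g q) * (LINT t|M. complex_of_real (g t) * f t))
      = complex_of_real z * f q"
      unfolding overlap by (simp add: algebra_simps)
  qed
  ultimately show ?eigen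
    using f_meas sq by blast
qed

lemma resolvent_mono:
  assumes "y \<le> z" "z < b" "q \<in> space M"
  shows "(g q)\<^sup>2 / (w q - y) \<le> (g q)\<^sup>2 / (w q - z)"
  using assms w_ge[OF assms(3)] by (intro divide_left_mono mult_pos_pos) auto

lemma secular_mono:
  assumes "y \<le> z" "z < b"
  shows "secular y \<le> secular z"
  unfolding secular_def using assms
  by (intro integral_mono secular_integrable resolvent_mono) auto

text \<open>
  Equality at two points would force \<open>g\<^sup>2 / (w - z) = g\<^sup>2 / (w - y)\<close> almost everywhere. This means
  \<open>g = 0\<close> almost everywhere, hence a vanishing secular function.
\<close>

lemma secular_strict_mono:
  assumes "y < z" "z < b" "secular y \<noteq> 0"
  shows "secular y < secular z"
proof (rule ccontr)
  assume "\<not> secular y < secular z"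
  with secular_mono[of y z] assms have "secular z - secular y = 0"
    by simp
  then have zero: "(LINT q|M. (g q)\<^sup>2 / (w q - z) - (g q)\<^sup>2 / (w q - y)) = 0"
    unfolding secular_def using assms secular_integrable by (subst Bochner_Integration.integral_diff) auto
  have "AE q in M. (g q)\<^sup>2 / (w q - z) - (g q)\<^sup>2 / (w q - y) = 0"
  proof (subst integral_nonneg_eq_0_iff_AE[symmetric])
    show "integrable M (\<lambda>q. (g q)\<^sup>2 / (w q - z) - (g q)\<^sup>2 / (w q - y))"
      using assms by (intro Bochner_Integration.integrable_diff secular_integrable) auto
    show "AE q in M. 0 \<le> (g q)\<^sup>2 / (w q - z) - (g q)\<^sup>2 / (w q - y)"
      using assms resolvent_mono[of y z] by (intro AE_I2) auto
  qed (rule zero)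
  then have "AE q in M. (g q)\<^sup>2 / (w q - y) = 0"
    using AE_space
  proof eventually_elim
    case (elim q)
    then have "(g q)\<^sup>2 * (z - y) = 0"
      using assms w_ge[of q] by (auto simp: field_simps)
    then show ?case using assms by simp
  qed
  then have "secular y = 0"
    unfolding secular_def by (rule integral_eq_zero_AE)
  with assms show False by simp
qed

text \<open>
  By the resolvent identity the integrands differ by \<open>(z - y) * g\<^sup>2 / ((w - z) * (w - y))\<close>, and both
  factors of the denominator are at least \<open>b - a\<close>.
\<close>

lemma secular_lipschitz:
  assumes "y \<le> z" "z \<le> a" "a < b"
  shows "secular z - secular y \<le> (z - y) * ((LINT q|M. (g q)\<^sup>2) / (b - a)\<^sup>2)"
proof -
  have "secular z - secular y = (LINT q|M. (g q)\<^sup>2 / (w q - z) - (g q)\<^sup>2 / (w q - y))"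
    unfolding secular_def using assms secular_integrable
    by (subst Bochner_Integration.integral_diff) auto
  also have "\<dots> \<le> (LINT q|M. (z - y) * ((g q)\<^sup>2 / (b - a)\<^sup>2))"
  proof (rule integral_mono)
    fix q assume q: "q \<in> space M"
    have pos: "0 < b - a" "b - a \<le> w q - z" "b - a \<le> w q - y"
      using assms w_ge[OF q] by auto
    then have "(b - a)\<^sup>2 \<le> (w q - z) * (w q - y)"
      unfolding power2_eq_square by (intro mult_mono) auto
    then have "(z - y) * (g q)\<^sup>2 / ((w q - z) * (w q - y)) \<le> (z - y) * (g q)\<^sup>2 / (b - a)\<^sup>2"
      using pos assms by (intro divide_left_mono mult_pos_pos) auto
    moreover have "(g q)\<^sup>2 / (w q - z) - (g q)\<^sup>2 / (w q - y)
        = (z - y) * (g q)\<^sup>2 / ((w q - z) * (w q - y))"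
      using pos by (simp add: field_simps)
    ultimately show "(g q)\<^sup>2 / (w q - z) - (g q)\<^sup>2 / (w q - y) \<le> (z - y) * ((g q)\<^sup>2 / (b - a)\<^sup>2)"
      by simp
  qed (use assms g_square_integrable in \<open>auto intro!: Bochner_Integration.integrable_diff secular_integrable\<close>)
  also have "\<dots> = (z - y) * ((LINT q|M. (g q)\<^sup>2) / (b - a)\<^sup>2)"
    by simp
  finally show ?thesis .
qed

lemma secular_continuous:
  assumes "a < b"
  shows "continuous_on {..a} secular"
proof (rule lipschitz_on_continuous_on)
  define L where "L = (LINT q|M. (g q)\<^sup>2) / (b - a)\<^sup>2"
  show "L-lipschitz_on {..a} secular"
  proof (rule lipschitz_onI)
    show "0 \<le> L" unfolding L_def by simp
    fix y z assume "y \<in> {..a}" "z \<in> {..a}"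
    then show "dist (secular y) (secular z) \<le> L * dist y z"
      using assms secular_lipschitz[of y z a] secular_lipschitz[of z y a]
        secular_mono[of y z] secular_mono[of z y]
      unfolding L_def dist_real_def by (cases "y \<le> z") (auto simp: mult.commute)
  qed
qed

text \<open>
  The intermediate value theorem applies because the secular function is continuous and tends to
  \<open>0\<close> at \<open>- \<infinity>\<close>.
\<close>

lemma secular_root_exists:
  assumes "0 < \<mu>" "a < b" "1 < \<mu> * secular a"
  shows "\<exists>z<a. \<mu> * secular z = 1"
proof -
  define G where "G = (LINT q|M. (g q)\<^sup>2)"
  have G: "0 \<le> G" unfolding G_def by simp
  \<comment> \<open>At distance at least \<open>\<mu> * G\<close> below \<open>b\<close>, the bound \<open>G / (b - y)\<close> on the secular function is at
    most \<open>1 / \<mu>\<close>; the summand \<open>1\<close> keeps the distance positive when \<open>G = 0\<close>.\<close>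
  define y where "y = min a (b - (\<mu> * G + 1))"
  have y: "y \<le> a" "y < b" "\<mu> * G + 1 \<le> b - y"
    using assms unfolding y_def by auto
  have "\<mu> * secular y \<le> \<mu> * (G / (b - y))"
    using secular_le[of y] assms y unfolding G_def by (intro mult_left_mono) auto
  also have "\<dots> \<le> 1"
    using y by (simp add: field_simps)
  finally have "\<mu> * secular y \<le> 1" .
  then have "\<exists>z\<ge>y. z \<le> a \<and> \<mu> * secular z = 1"
    using assms y
    by (intro IVT') (auto intro!: continuous_intros continuous_on_subset[OF secular_continuous[of a]])
  then show ?thesis
    using assms by (metis less_eq_real_def order.irrefl)
qed

lemma secular_root_unique:
  assumes "\<mu> * secular y = 1" "\<mu> * secular z = 1" "y < b" "z < b"
  shows "y = z"
  using assms secular_strict_mono[of y z] secular_strict_mono[of z y]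
  by (metis linorder_neqE mult_cancel_left mult_zero_left mult_zero_right order.irrefl zero_neq_one)

text \<open>
  Along a sequence increasing to \<open>b\<close> the integrands increase to \<open>g\<^sup>2 / (w - b)\<close>, so a uniform bound on
  the secular function below \<open>b\<close> passes to \<open>b\<close> by monotone convergence and yields integrability
  there. The points with \<open>w = b\<close> must form a null set: where \<open>g \<noteq> 0\<close> the integrands blow up there
  while \<open>g\<^sup>2 / (w - b)\<close> is read as \<open>0\<close>. Integrability at \<open>b\<close> is part of the conclusion because the
  value \<open>secular b\<close> of a divergent integral would be \<open>0\<close> and carry no information.
\<close>

lemma secular_threshold:
  assumes ne: "AE q in M. w q \<noteq> b" and bound: "\<And>z. z < b \<Longrightarrow> secular z \<le> C"
  shows "integrable M (\<lambda>q. (g q)\<^sup>2 / (w q - b))" "secular b \<le> C"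
proof -
  define s :: "nat \<Rightarrow> real" where "s n = b - inverse (real (Suc n))" for n
  have s_less: "s n < b" for n unfolding s_def by simp
  have s_mono: "s i \<le> s j" if "i \<le> j" for i j
    using that unfolding s_def by (simp add: field_simps)
  have s_lim: "s \<longlonglongrightarrow> b"
    unfolding s_def using tendsto_diff[OF tendsto_const LIMSEQ_inverse_real_of_nat, of b] by simp
  have "incseq (\<lambda>n. secular (s n))"
    by (intro incseq_SucI secular_mono s_mono s_less) simp
  then obtain L where L: "(\<lambda>n. secular (s n)) \<longlonglongrightarrow> L"
    using incseq_convergent[of "\<lambda>n. secular (s n)" C] bound s_less by blast
  have int: "\<And>n. integrable M (\<lambda>q. (g q)\<^sup>2 / (w q - s n))"
    by (rule secular_integrable[OF s_less])
  have mono: "AE q in M. mono (\<lambda>n. (g q)\<^sup>2 / (w q - s n))"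
    by (intro AE_I2 monoI resolvent_mono s_mono s_less)
  have lim: "AE q in M. (\<lambda>n. (g q)\<^sup>2 / (w q - s n)) \<longlonglongrightarrow> (g q)\<^sup>2 / (w q - b)"
    using ne by eventually_elim (intro tendsto_intros s_lim, simp)
  have ilim: "(\<lambda>n. LINT q|M. (g q)\<^sup>2 / (w q - s n)) \<longlonglongrightarrow> L"
    using L unfolding secular_def .
  have meas: "(\<lambda>q. (g q)\<^sup>2 / (w q - b)) \<in> borel_measurable M" by measurable
  show "integrable M (\<lambda>q. (g q)\<^sup>2 / (w q - b))"
    by (rule integrable_monotone_convergence[OF int mono lim ilim meas])
  have "secular b = L"
    unfolding secular_def by (rule integral_monotone_convergence[OF int mono lim ilim meas])
  also have "L \<le> C"
    by (rule LIMSEQ_le_const2[OF L]) (use bound s_less in blast)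
  finally show "secular b \<le> C" .
qed

end

section \<open>Periodic functions on the torus\<close>

lemma torus_periodic_axis_int:
  assumes "torus_periodic f"
  shows "f (x + axis i (2 * pi * of_int k)) = f x"
proof -
  have nat: "f (x + axis i (2 * pi * real n)) = f x" for n x
  proof (induction n)
    case 0
    have "x + axis i (2 * pi * real 0) = x" by (simp add: vec_eq_iff axis_def)
    then show ?case by (rule arg_cong)
  next
    case (Suc n)
    have "x + axis i (2 * pi * real (Suc n)) = (x + axis i (2 * pi * real n)) + axis i (2 * pi)"
      by (simp add: vec_eq_iff axis_def algebra_simps)
    with assms Suc show ?case unfolding torus_periodic_def by metis
  qed
  show ?thesis
  proof (cases k rule: int_cases2)
    case (nonneg n)
    then show ?thesis using nat[of x n] by simp
  next
    case (nonpos n)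
    have "x + axis i (2 * pi * of_int k) + axis i (2 * pi * real n) = x"
      unfolding nonpos by (simp add: vec_eq_iff axis_def)
    then show ?thesis using nat[of "x + axis i (2 * pi * of_int k)" n] by metis
  qed
qed

text \<open>
  Minima over the compact cube and points where a periodic function is nonzero can be moved into
  the half-open fundamental cube.
\<close>

lemma torus_periodic_representative:
  assumes "torus_periodic f"
  shows "\<exists>y\<in>torus. f y = f x"
proof -
  \<comment> \<open>The largest number of periods that keeps the coordinate at most \<open>pi\<close>.\<close>
  define k :: "3 \<Rightarrow> int" where "k i = \<lfloor>(pi - x $ i) / (2 * pi)\<rfloor>" for i
  define y where "y = x + axis 1 (2 * pi * of_int (k 1)) + axis 2 (2 * pi * of_int (k 2))
                        + axis 3 (2 * pi * of_int (k 3))"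
  have "f y = f x"
    unfolding y_def by (simp add: torus_periodic_axis_int[OF assms])
  moreover have "y \<in> torus"
  proof -
    have y_nth: "y $ i = x $ i + 2 * pi * of_int (k i)" for i
      using exhaust_3[of i] unfolding y_def by (auto simp: axis_def)
    have k: "of_int (k i) \<le> (pi - x $ i) / (2 * pi)" "(pi - x $ i) / (2 * pi) < of_int (k i) + 1" for i
      unfolding k_def by linarith+
    have "- pi < y $ i" "y $ i \<le> pi" for i
      using k[of i] unfolding y_nth by (simp_all add: field_simps)
    then show ?thesis
      by (simp add: torus_def)
  qed
  ultimately show ?thesis by blast
qed

definition closed_cube :: "(real ^ 3) set" where
  "closed_cube = cbox (\<chi> i. - pi) (\<chi> i. pi)"

definition open_cube :: "(real ^ 3) set" where
  "open_cube = box (\<chi> i. - pi) (\<chi> i. pi)"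

lemma open_cube_subset: "open_cube \<subseteq> torus" and torus_subset: "torus \<subseteq> closed_cube"
  by (auto simp: open_cube_def closed_cube_def torus_def mem_box_cart less_imp_le)

lemma torus_sets: "torus \<in> sets lebesgue"
proof -
  have "torus = (\<Inter>i. {x. - pi < x $ i} \<inter> {x. x $ i \<le> pi})"
    unfolding torus_def by auto
  also have "\<dots> \<in> sets borel"
    by (intro sets.finite_INT sets.Int borel_open borel_closed
        open_halfspace_component_gt_cart closed_halfspace_component_le_cart) auto
  finally show ?thesis by auto
qed

lemma torus_lmeasurable: "torus \<in> lmeasurable"
  using torus_sets torus_subset unfolding closed_cube_def
  by (metis bounded_cbox bounded_set_imp_lmeasurable bounded_subset)

lemma space_torus [simp]: "space torus_measure = torus"
  by (simp add: space_restrict_space)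

lemma zero_in_torus: "0 \<in> torus"
  by (simp add: torus_def pi_ge_zero)

lemma continuous_torus_measurable:
  assumes "continuous_on UNIV (f :: real ^ 3 \<Rightarrow> real)"
  shows "f \<in> borel_measurable torus_measure"
  by (rule continuous_imp_measurable_on_sets_lebesgue[OF continuous_on_subset[OF assms] torus_sets]) simp

lemma continuous_torus_integrable:
  assumes "continuous_on UNIV (f :: real ^ 3 \<Rightarrow> real)"
  shows "integrable torus_measure f"
proof -
  have "compact (f ` closed_cube)"
    unfolding closed_cube_def
    by (intro compact_continuous_image compact_cbox continuous_on_subset[OF assms]) auto
  then obtain B where B: "\<And>x. x \<in> closed_cube \<Longrightarrow> norm (f x) \<le> B"
    using compact_imp_bounded bounded_iff by (metis imageI)
  interpret finite_measure torus_measure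
    using torus_lmeasurable by (auto intro: finite_measure_lebesgue_on)
  show ?thesis
    using B torus_subset
    by (intro integrable_const_bound[where B = B] AE_I2 continuous_torus_measurable assms) auto
qed

text \<open>
  If \<open>f\<close> were nonzero somewhere, it would be nonzero at a point of the half-open cube, hence by
  continuity on a nonempty open subset of the open cube, and such a set has positive measure.
\<close>

lemma continuous_periodic_AE_zero:
  assumes cont: "continuous_on UNIV (f :: real ^ 3 \<Rightarrow> real)" and per: "torus_periodic f"
    and ae: "AE q in torus_measure. f q = 0"
  shows "f x = 0"
proof (rule ccontr)
  assume "f x \<noteq> 0"
  define N where "N = {q. f q \<noteq> 0}"
  have "open N"
    unfolding N_def using open_vimage[OF _ cont, of "- {0}"] by (simp add: vimage_def open_Compl)
  obtain y where y: "y \<in> torus" "f y = f x"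
    using torus_periodic_representative[OF per] by blast
  have "0 \<in> open_cube"
    by (simp add: open_cube_def mem_box_cart)
  then have "closure open_cube = closed_cube"
    unfolding open_cube_def closed_cube_def by (intro closure_box) auto
  with y \<open>f x \<noteq> 0\<close> torus_subset have "y \<in> N \<inter> closure open_cube"
    by (auto simp: N_def)
  with \<open>open N\<close> have "N \<inter> open_cube \<noteq> {}"
    using open_Int_closure_eq_empty by blast
  moreover have "open (N \<inter> open_cube)"
    using \<open>open N\<close> by (auto simp: open_cube_def)
  moreover have "negligible (N \<inter> open_cube)"
  proof -
    have "AE q in lebesgue. q \<in> torus \<longrightarrow> f q = 0"
      using ae torus_sets by (simp add: AE_restrict_space_iff)
    then obtain Z where "Z \<in> null_sets lebesgue" "{q. \<not> (q \<in> torus \<longrightarrow> f q = 0)} \<subseteq> Z"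
      by (auto simp: eventually_ae_filter)
    then show ?thesis
      unfolding negligible_iff_null_sets[symmetric] N_def
      using open_cube_subset by (auto elim!: negligible_subset)
  qed
  ultimately show False
    using open_not_negligible by blast
qed

section \<open>Real-analytic functions are continuous\<close>

text \<open>
  Convergence at the corner \<open>x + (s, s, s)\<close> of a cube inside the ball is absolute, and the terms
  there dominate those at every point of the cube of half-width \<open>s\<close> around \<open>x\<close>. The Weierstrass test
  then gives uniform convergence, so \<open>f\<close> is a uniform limit of polynomials near \<open>x\<close>.
\<close>

lemma real_analytic_continuous:
  assumes "real_analytic f"
  shows "continuous_on UNIV f"
proof -
  have "isCont f x" for x
  proof -
    obtain r and a :: "nat ^ 3 \<Rightarrow> real" where r: "r > 0"
      and ball: "\<forall>y\<in>ball x r. ((\<lambda>k. a k * (\<Prod>i\<in>UNIV. (y $ i - x $ i) ^ (k $ i))) has_sum f y) UNIV"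
      using spec[OF assms[unfolded real_analytic_def], of x] by (elim exE conjE)
    have series: "((\<lambda>k. a k * (\<Prod>i\<in>UNIV. (y $ i - x $ i) ^ (k $ i))) has_sum f y) UNIV"
      if "y \<in> ball x r" for y
      by (rule bspec[OF ball that])
    \<comment> \<open>Any \<open>s < r / sqrt 3\<close> places the cube inside the ball; \<open>r / 4\<close> suffices even for the
      \<open>l\<^sub>1\<close> estimate of the norm.\<close>
    define s where "s = r / 4"
    define Y where "Y = {y. \<forall>i. \<bar>y $ i - x $ i\<bar> \<le> s}"
    have s: "0 < s" using r by (simp add: s_def)
    have Y_ball: "Y \<subseteq> ball x r"
    proof
      fix y assume y: "y \<in> Y"
      have "norm (y - x) \<le> (\<Sum>i\<in>UNIV. \<bar>(y - x) $ i\<bar>)"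
        by (rule norm_le_l1_cart)
      also have "\<dots> \<le> (\<Sum>i\<in>(UNIV :: 3 set). s)"
        using y unfolding Y_def by (intro sum_mono) auto
      also have "\<dots> < r"
        using r by (simp add: s_def)
      finally show "y \<in> ball x r"
        by (simp add: dist_norm norm_minus_commute)
    qed
    define corner where "corner = (\<chi> i. x $ i + s)"
    have "corner \<in> Y"
      using s unfolding corner_def Y_def by simp
    then have "(\<lambda>k. a k * (\<Prod>i\<in>UNIV. (corner $ i - x $ i) ^ (k $ i))) summable_on UNIV"
      using series Y_ball has_sum_imp_summable by blast
    then have "(\<lambda>k. a k * (\<Prod>i\<in>UNIV. s ^ (k $ i))) summable_on UNIV"
      by (simp add: corner_def)
    then have "(\<lambda>k. norm (a k * (\<Prod>i\<in>UNIV. s ^ (k $ i)))) summable_on UNIV"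
      by (rule iffD1[OF summable_on_iff_abs_summable_on_real])
    then have limit: "uniform_limit Y (\<lambda>K y. \<Sum>k\<in>K. a k * (\<Prod>i\<in>UNIV. (y $ i - x $ i) ^ (k $ i))) f
        (finite_subsets_at_top UNIV)"
    proof (rule Weierstrass_m_test_general'[rotated 2])
      fix k y assume "y \<in> Y"
      then show "norm (a k * (\<Prod>i\<in>UNIV. (y $ i - x $ i) ^ (k $ i)))
          \<le> norm (a k * (\<Prod>i\<in>UNIV. s ^ (k $ i)))"
        using s unfolding Y_def
        by (auto simp: abs_mult abs_prod power_abs intro!: mult_left_mono prod_mono power_mono)
    next
      fix y assume "y \<in> Y"
      with Y_ball show "((\<lambda>k. a k * (\<Prod>i\<in>UNIV. (y $ i - x $ i) ^ (k $ i))) has_sum f y) UNIV"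
        by (intro series) auto
    qed
    have partial: "\<forall>\<^sub>F K in finite_subsets_at_top UNIV.
        continuous_on Y (\<lambda>y. \<Sum>k\<in>K. a k * (\<Prod>i\<in>UNIV. (y $ i - x $ i) ^ (k $ i)))"
      by (intro always_eventually allI continuous_intros)
    have cont: "continuous_on Y f"
      by (rule uniform_limit_theorem[OF partial limit]) simp
    have "ball x s \<subseteq> Y"
    proof
      fix y assume "y \<in> ball x s"
      then have "norm (y - x) < s" by (simp add: dist_norm norm_minus_commute)
      then show "y \<in> Y"
        unfolding Y_def using component_le_norm_cart[of "y - x"]
        by (auto intro: order.trans less_imp_le)
    qed
    with cont have "continuous_on (ball x s) f"
      by (rule continuous_on_subset)
    then show ?thesis
      using s by (simp add: continuous_on_eq_continuous_at)
  qed
  then show ?thesis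
    by (simp add: continuous_on_eq_continuous_at)
qed

section \<open>The three-particle dispersion\<close>

lemma u_continuous: "continuous_on UNIV (u p)"
  unfolding u_def[abs_def] dispersion_def by (intro continuous_intros)

lemma u_periodic: "torus_periodic (u p)"
proof -
  have "cos (t - (s + 2 * pi)) = cos (t - s)" for t s :: real
    using cos_periodic[of "t - (s + 2 * pi)"] by (simp add: algebra_simps)
  then show ?thesis
    unfolding torus_periodic_def u_def dispersion_def forall_3 by (auto simp: axis_def)
qed

text \<open>
  The least element in the definition of \<open>m\<close> exists although the fundamental cube is not closed:
  \<open>u p\<close> attains its minimum over the closed cube, and periodicity moves the minimiser into
  \<open>torus\<close>.
\<close>

lemma m_attained: "\<exists>q\<in>torus. m p = u p q" and m_le: "q \<in> torus \<Longrightarrow> m p \<le> u p q"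
proof -
  have "compact closed_cube" "closed_cube \<noteq> {}"
    using zero_in_torus torus_subset by (auto simp: closed_cube_def)
  then have "\<exists>x\<in>closed_cube. \<forall>q\<in>closed_cube. u p x \<le> u p q"
    by (rule continuous_attains_inf) (rule continuous_on_subset[OF u_continuous subset_UNIV])
  then obtain x where x: "\<And>q. q \<in> closed_cube \<Longrightarrow> u p x \<le> u p q"
    by blast
  obtain y where y: "y \<in> torus" "u p y = u p x"
    using torus_periodic_representative[OF u_periodic] by blast
  have "m p = u p y"
    unfolding m_def
  proof (rule Least_equality)
    show "u p y \<in> u p ` torus"
      using y(1) by (rule imageI)
    show "u p y \<le> z" if "z \<in> u p ` torus" for z
      using that x y(2) torus_subset by auto
  qed
  then show "\<exists>q\<in>torus. m p = u p q" "q \<in> torus \<Longrightarrow> m p \<le> u p q"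
    using x y torus_subset by (blast, auto)
qed

lemma u_0: "u 0 q = 2 * dispersion q"
  by (simp add: u_def dispersion_def)

lemma u_0_nonneg: "0 \<le> u 0 q"
proof -
  have "0 \<le> dispersion q"
    using cos_le_one[of "q $ 1"] cos_le_one[of "q $ 2"] cos_le_one[of "q $ 3"]
    unfolding dispersion_def by linarith
  then show ?thesis
    by (simp add: u_0)
qed

text \<open>
  Each of the three terms \<open>1 - cos (q $ i)\<close> is nonnegative, so they vanish together. Thus the
  threshold \<open>0\<close> is attained at a single point of the torus, which gives \<open>u_0_AE_nonzero\<close>.
\<close>

lemma u_0_eq_0:
  assumes "q \<in> torus" "u 0 q = 0"
  shows "q = 0"
proof -
  have "cos (q $ 1) = 1 \<and> cos (q $ 2) = 1 \<and> cos (q $ 3) = 1"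
  proof -
    have "3 - cos (q $ 1) - cos (q $ 2) - cos (q $ 3) = 0"
      using assms(2) unfolding u_0 dispersion_def[symmetric] by simp
    then show ?thesis
      using cos_le_one[of "q $ 1"] cos_le_one[of "q $ 2"] cos_le_one[of "q $ 3"] by linarith
  qed
  then have cos_1: "cos (q $ i) = 1" for i
    using exhaust_3[of i] by auto
  have "q $ i = 0" for i
  proof -
    obtain n :: int where n: "q $ i = of_int n * 2 * pi"
      using cos_1[of i] cos_one_2pi_int by blast
    have "- pi < q $ i" "q $ i \<le> pi"
      using assms(1) by (auto simp: torus_def)
    then have "(- 1) * pi < (2 * of_int n) * pi" "(2 * of_int n) * pi \<le> 1 * pi"
      unfolding n by auto
    then have "- 1 < 2 * real_of_int n" "2 * real_of_int n \<le> 1"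
      unfolding mult_less_cancel_right_pos[OF pi_gt_zero] mult_le_cancel_right_pos[OF pi_gt_zero]
      by auto
    then have "n = 0" by linarith
    with n show ?thesis by simp
  qed
  then show ?thesis by (simp add: vec_eq_iff)
qed

lemma m_0: "m 0 = 0"
proof -
  obtain q where "q \<in> torus" "m 0 = u 0 q"
    using m_attained by blast
  then have "0 \<le> m 0" using u_0_nonneg by simp
  moreover have "m 0 \<le> 0"
    using m_le[OF zero_in_torus, of 0] by (simp add: u_0 dispersion_def)
  ultimately show ?thesis by simp
qed

lemma u_0_AE_nonzero: "AE q in torus_measure. u 0 q \<noteq> 0"
proof -
  have "AE q in lebesgue. q \<in> torus \<longrightarrow> u 0 q \<noteq> 0"
    by (rule AE_I'[of "{0 :: real ^ 3}"])
       (auto simp: negligible_iff_null_sets[symmetric] dest: u_0_eq_0)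
  then show ?thesis
    using torus_sets by (simp add: AE_restrict_space_iff)
qed

section \<open>Eigenvalues below the essential spectrum\<close>

lemma u_rank_one:
  assumes "continuous_on UNIV \<phi>"
  shows "rank_one_perturbation torus_measure (u p) \<phi> (m p)"
proof
  show "integrable torus_measure (\<lambda>q. (\<phi> q)\<^sup>2)"
    by (intro continuous_torus_integrable continuous_intros assms)
qed (auto intro: continuous_torus_measurable u_continuous assms m_le)

lemma eigenvalue_below_iff:
  assumes "continuous_on UNIV \<phi>"
  shows "eigenvalue_below \<phi> \<mu> p z \<longleftrightarrow>
    z < m p \<and> \<mu> * rank_one_perturbation.secular torus_measure (u p) \<phi> z = 1"
  using rank_one_perturbation.eigenvalue_iff_secular[OF u_rank_one[OF assms], of z p \<mu>]
  unfolding eigenvalue_below_def eigenvalue_def L2_torus_def h_def h0_def v_def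
  by (auto simp: Bex_def)

lemma eigenvalue_below_unique:
  assumes "continuous_on UNIV \<phi>" "eigenvalue_below \<phi> \<mu> p y" "eigenvalue_below \<phi> \<mu> p z"
  shows "y = z"
  using assms rank_one_perturbation.secular_root_unique[OF u_rank_one[OF assms(1)]]
  by (auto simp: eigenvalue_below_iff)

text \<open>
  Nonnegativity holds even if the defining integral diverges: it is then \<open>0\<close>, and so is its inverse.
\<close>

lemma mu0_nonneg: "0 \<le> mu0 \<phi>"
  unfolding mu0_def using u_0_nonneg by simp

text \<open>
  The critical coupling \<open>mu0 \<phi>\<close> is the inverse of the secular function at the threshold \<open>0\<close>. A bound
  by \<open>inverse \<mu>\<close> below the threshold would persist at \<open>0\<close> with a convergent integral, and the
  positivity of that integral would turn the bound into \<open>\<mu> \<le> mu0 \<phi>\<close>.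
\<close>

lemma supercritical_secular_0:
  assumes cont: "continuous_on UNIV \<phi>" and per: "torus_periodic \<phi>" and nz: "\<exists>q. \<phi> q \<noteq> 0"
    and \<mu>: "mu0 \<phi> < \<mu>"
  shows "\<exists>z<0. 1 < \<mu> * rank_one_perturbation.secular torus_measure (u 0) \<phi> z"
proof (rule ccontr)
  interpret rank_one_perturbation torus_measure "u 0" \<phi> 0
    using u_rank_one[OF cont, of 0] by (simp add: m_0)
  have "0 < \<mu>" using \<mu> mu0_nonneg[of \<phi>] by simp
  assume "\<not> (\<exists>z<0. 1 < \<mu> * secular z)"
  then have bound: "secular z \<le> inverse \<mu>" if "z < 0" for z
    using that \<open>0 < \<mu>\<close> by (force simp: field_simps not_less)
  note threshold = secular_threshold[OF u_0_AE_nonzero bound]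
  have mu0_eq: "mu0 \<phi> = inverse (secular 0)"
    unfolding mu0_def secular_def by (simp add: divide_inverse)
  have nonneg: "0 \<le> (\<phi> q)\<^sup>2 / (u 0 q - 0)" for q
    using u_0_nonneg by simp
  have "secular 0 \<noteq> 0"
  proof
    assume "secular 0 = 0"
    then have "AE q in torus_measure. (\<phi> q)\<^sup>2 / (u 0 q - 0) = 0"
      unfolding secular_def using integral_nonneg_eq_0_iff_AE[OF threshold(1)] nonneg by simp
    then have "AE q in torus_measure. \<phi> q = 0"
      using u_0_AE_nonzero by eventually_elim simp
    then show False
      using continuous_periodic_AE_zero[OF cont per] nz by blast
  qed
  moreover have "0 \<le> secular 0"
    unfolding secular_def using nonneg by (intro integral_nonneg_AE AE_I2)
  ultimately have "0 < secular 0" by simp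
  then have "\<mu> \<le> mu0 \<phi>"
    unfolding mu0_eq using threshold(2) \<open>0 < \<mu>\<close> by (metis inverse_inverse_eq le_imp_inverse_le)
  with \<mu> show False by simp
qed

theorem theorem2p8:
  fixes \<phi> :: "real ^ 3 \<Rightarrow> real" and \<mu> :: real and p :: "real ^ 3"
  assumes "torus_periodic \<phi>"
    and "real_analytic \<phi>"
    and "\<And>q. \<phi> (- q) = \<phi> q"
    and "\<exists>q. \<phi> q \<noteq> 0"
    and "\<mu> > mu0 \<phi>"
    and "p \<in> torus"
    and e_mu0_exists: "p \<noteq> 0 \<Longrightarrow> \<exists>!z. 0 < z \<and> eigenvalue_below \<phi> (mu0 \<phi>) p z"
  shows "(\<exists>!z. eigenvalue_below \<phi> \<mu> p z)
    \<and> (p \<noteq> 0 \<longrightarrow> e \<phi> \<mu> p < e_mu0 \<phi> p \<and> e_mu0 \<phi> p < m p)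
    \<and> e \<phi> \<mu> 0 < 0"
proof -
  have cont: "continuous_on UNIV \<phi>"
    using \<open>real_analytic \<phi>\<close> by (rule real_analytic_continuous)
  have "0 < \<mu>"
    using \<open>mu0 \<phi> < \<mu>\<close> mu0_nonneg[of \<phi>] by simp
  have unique: "\<exists>!z. eigenvalue_below \<phi> \<mu> k z" if "eigenvalue_below \<phi> \<mu> k z" for k z
    using that eigenvalue_below_unique[OF cont] by blast
  have e_eq: "e \<phi> \<mu> k = z" if "eigenvalue_below \<phi> \<mu> k z" for k z
    unfolding e_def using unique[OF that] that by (rule the1_equality)
  have below: "\<exists>z<a. eigenvalue_below \<phi> \<mu> k z"
    if "a < m k" "1 < \<mu> * rank_one_perturbation.secular torus_measure (u k) \<phi> a" for k a
    using rank_one_perturbation.secular_root_exists[OF u_rank_one[OF cont] \<open>0 < \<mu>\<close> that] that(1)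
    unfolding eigenvalue_below_iff[OF cont] by force
  obtain a where a: "a < 0" "1 < \<mu> * rank_one_perturbation.secular torus_measure (u 0) \<phi> a"
    using supercritical_secular_0[OF cont] assms by blast
  then obtain z0 where z0: "z0 < a" "eigenvalue_below \<phi> \<mu> 0 z0"
    using below[of a 0] m_0 by auto
  then have zero: "e \<phi> \<mu> 0 < 0"
    using e_eq a by force
  show ?thesis
  proof (cases "p = 0")
    case True
    then show ?thesis using unique z0 zero by auto
  next
    case False
    \<comment> \<open>Where the critical coupling gives \<open>1\<close>, the larger coupling \<open>\<mu>\<close> gives more than \<open>1\<close>.\<close>
    define c where "c = e_mu0 \<phi> p"
    have "eigenvalue_below \<phi> (mu0 \<phi>) p c"
      unfolding c_def e_mu0_def using theI'[OF e_mu0_exists[OF False]] by blast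
    then have c: "c < m p"
      and root: "mu0 \<phi> * rank_one_perturbation.secular torus_measure (u p) \<phi> c = 1"
      by (auto simp: eigenvalue_below_iff[OF cont])
    have "0 < rank_one_perturbation.secular torus_measure (u p) \<phi> c"
      using root mu0_nonneg[of \<phi>] by (metis not_less mult_nonneg_nonpos not_one_le_zero)
    with root \<open>mu0 \<phi> < \<mu>\<close>
    have "1 < \<mu> * rank_one_perturbation.secular torus_measure (u p) \<phi> c"
      by (metis mult_strict_right_mono)
    then obtain z where "z < c" "eigenvalue_below \<phi> \<mu> p z"
      using below c by blast
    then show ?thesis
      using unique e_eq zero c False unfolding c_def by auto
  qed
qed

end
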